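(* Let $(G_n)_{n\in\omega}$ be a bi-balanced tower of topological groups, let $G=\bigcup_{n\in\omega}G_n$, and let $\overleftrightarrow{G}=(G,\overleftrightarrow{\tau})$. Then the identity map $\overleftrightarrow{G}\to\mathrm{g}\text{-}\varinjlim G_n$ is a homeomorphism, and hence the topology of $\mathrm{g}\text{-}\varinjlim G_n$ coincides with the topology $\overleftrightarrow{\tau}$.
   Context: $\omega=\{0,1,2,\dots\}$. Topological groups are not assumed Hausdorff. A tower of topological groups is a sequence $G_0\subset G_1\subset G_2\subset\cdots$ of topological groups in which each $G_n$ is a topological subgroup of $G_{n+1}$ (a subgroup carrying the subspace topology); $G=\bigcup_{n\in\omega}G_n$ is its union, a group with neutral element $e$. Bi-balanced triples and towers: for a group $K$, a subgroup $H\subset K$ and a subset $U\subset K$ put $\sqrt[H]{U}=\{x\in K: hxh^{-1}\in U\text{ for all }h\in H\}$ (the largest subset of $U$ invariant under conjugation by elements of $H$). A triple $(K,\Gamma,H)$ of topological groups $H\subset\Gamma\subset K$ (topological subgroups) is bi-balanced if for any neighborhoods $V\subset\Gamma$ and $U\subset K$ of the neutral element $e$ (in $\Gamma$ and in $K$, respectively) the product $\sqrt[H]{U}\cdot V\cdot\sqrt[H]{U}$ is a neighborhood of $e$ in $K$. A tower $(G_n)_{n\in\omega}$ is bi-balanced if each triple $(G_{n+2},G_{n+1},G_n)$, $n\in\omega$, is bi-balanced. $\mathrm{g}\text{-}\varinjlim G_n$ is the group $G$ endowed with the strongest (not necessarily Hausdorff) topology that turns $G$ into a topological group and makes all the inclusions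 $G_n\to G$, $n\in\omega$, continuous. For each $n$ fix a neighborhood base $\mathcal B_n$ at $e$ in $G_n$ consisting of open symmetric neighborhoods $U=U^{-1}\subset G_n$ of $e$. For a sequence $(U_n)_{n\in\omega}$ of subsets of $G$ put $$\overleftrightarrow{\prod}_{n\in\omega}U_n=\bigcup_{m\in\omega}U_m\cdots U_1U_0\,U_0U_1\cdots U_m .$$ The topology $\overleftrightarrow{\tau}$ on $G$ is the one generated by the base $$\Big\{x\cdot\big(\overleftrightarrow{\prod}_{n\in\omega}U_n\big)\cdot y:\ x,y\in G,\ (U_n)_{n\in\omega}\in\prod_{n\in\omega}\mathcal B_n\Big\}.$$ With this topology $G$ is a semitopological group (left and right translations are continuous) with continuous inversion, and the sets $\overleftrightarrow{\prod}_{n\in\omega}U_n$ with $(U_n)\in\prod_n\mathcal B_n$ form a neighborhood base at $e$. *)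

theory Defs
  imports "HOL-Analysis.Analysis" "HOL-Algebra.Coset"
begin

text \<open>Topological groups are not required to be Hausdorff.\<close>

definition topological_group :: "('a, 'b) monoid_scheme \<Rightarrow> 'a topology \<Rightarrow> bool" where
  "topological_group G T \<longleftrightarrow>
     group G \<and> topspace T = carrier G \<and>
     continuous_map (prod_topology T T) T (\<lambda>(x, y). x \<otimes>\<^bsub>G\<^esub> y) \<and>
     continuous_map T T (\<lambda>x. inv\<^bsub>G\<^esub> x)"

text \<open>Neighborhoods need not be open.\<close>

definition is_neighborhood :: "'a topology \<Rightarrow> 'a \<Rightarrow> 'a set \<Rightarrow> bool" where
  "is_neighborhood T x N \<longleftrightarrow> N \<subseteq> topspace T \<and> x \<in> T interior_of N"

text \<open>
  A tower is given inside the group structure of its union: the group \<open>G\<close> has carrier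
  \<open>\<Union>n. H n\<close>, and the \<open>n\<close>-th topological group of the tower is the subgroup \<open>H n\<close> of \<open>G\<close>
  with the topology \<open>T n\<close>.
\<close>

definition group_tower ::
    "('a, 'b) monoid_scheme \<Rightarrow> (nat \<Rightarrow> 'a set) \<Rightarrow> (nat \<Rightarrow> 'a topology) \<Rightarrow> bool" where
  "group_tower G H T \<longleftrightarrow>
     group G \<and> carrier G = (\<Union>n. H n) \<and>
     (\<forall>n. subgroup (H n) G \<and> topological_group (G\<lparr>carrier := H n\<rparr>) (T n) \<and>
          H n \<subseteq> H (Suc n) \<and> T n = subtopology (T (Suc n)) (H n))"

definition conj_root :: "('a, 'b) monoid_scheme \<Rightarrow> 'a set \<Rightarrow> 'a set \<Rightarrow> 'a set" where
  "conj_root K H U = {x \<in> carrier K. \<forall>h\<in>H. h \<otimes>\<^bsub>K\<^esub> x \<otimes>\<^bsub>K\<^esub> inv\<^bsub>K\<^esub> h \<in> U}"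

text \<open>
  The triple \<open>(K, \<Gamma>, H)\<close>, where \<open>K\<close> carries the topology \<open>T\<close> and the subgroups
  \<open>H \<subseteq> \<Gamma>\<close> of \<open>K\<close> carry the subspace topologies.
\<close>

definition bi_balanced_triple ::
    "('a, 'b) monoid_scheme \<Rightarrow> 'a topology \<Rightarrow> 'a set \<Rightarrow> 'a set \<Rightarrow> bool" where
  "bi_balanced_triple K T \<Gamma> H \<longleftrightarrow>
     topological_group K T \<and> subgroup \<Gamma> K \<and> subgroup H K \<and> H \<subseteq> \<Gamma> \<and>
     (\<forall>V U. is_neighborhood (subtopology T \<Gamma>) \<one>\<^bsub>K\<^esub> V \<and> is_neighborhood T \<one>\<^bsub>K\<^esub> U \<longrightarrow>
        is_neighborhood T \<one>\<^bsub>K\<^esub> (conj_root K H U <#>\<^bsub>K\<^esub> V <#>\<^bsub>K\<^esub> conj_root K H U))"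

definition bi_balanced_tower ::
    "('a, 'b) monoid_scheme \<Rightarrow> (nat \<Rightarrow> 'a set) \<Rightarrow> (nat \<Rightarrow> 'a topology) \<Rightarrow> bool" where
  "bi_balanced_tower G H T \<longleftrightarrow>
     group_tower G H T \<and>
     (\<forall>n. bi_balanced_triple (G\<lparr>carrier := H (n + 2)\<rparr>) (T (n + 2)) (H (n + 1)) (H n))"

definition strongest_group_topology ::
    "('a, 'b) monoid_scheme \<Rightarrow> (nat \<Rightarrow> 'a topology) \<Rightarrow> 'a topology \<Rightarrow> bool" where
  "strongest_group_topology G T \<tau> \<longleftrightarrow>
     topological_group G \<tau> \<and> (\<forall>n. continuous_map (T n) \<tau> (\<lambda>x. x)) \<and>
     (\<forall>\<sigma>. topological_group G \<sigma> \<and> (\<forall>n. continuous_map (T n) \<sigma> (\<lambda>x. x)) \<longrightarrow>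
        (\<forall>U. openin \<sigma> U \<longrightarrow> openin \<tau> U))"

text \<open>
  The topology of the direct limit in the category of topological groups; see
  \<open>strongest_group_topology_g_lim\<close> below for existence and uniqueness.
\<close>

definition g_lim_topology ::
    "('a, 'b) monoid_scheme \<Rightarrow> (nat \<Rightarrow> 'a topology) \<Rightarrow> 'a topology" where
  "g_lim_topology G T = (THE \<tau>. strongest_group_topology G T \<tau>)"

definition open_symmetric_base :: "('a, 'b) monoid_scheme \<Rightarrow> 'a topology \<Rightarrow> 'a set set \<Rightarrow> bool" where
  "open_symmetric_base G T \<B> \<longleftrightarrow>
     (\<forall>U\<in>\<B>. openin T U \<and> \<one>\<^bsub>G\<^esub> \<in> U \<and> set_inv\<^bsub>G\<^esub> U = U) \<and>
     (\<forall>W. is_neighborhood T \<one>\<^bsub>G\<^esub> W \<longrightarrow> (\<exists>U\<in>\<B>. U \<subseteq> W))"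

text \<open>\<open>bi_prod_upto G U m\<close> is \<open>U m \<cdots> U 1 U 0 U 0 U 1 \<cdots> U m\<close>.\<close>

primrec bi_prod_upto :: "('a, 'b) monoid_scheme \<Rightarrow> (nat \<Rightarrow> 'a set) \<Rightarrow> nat \<Rightarrow> 'a set" where
  "bi_prod_upto G U 0 = U 0 <#>\<^bsub>G\<^esub> U 0"
| "bi_prod_upto G U (Suc m) = U (Suc m) <#>\<^bsub>G\<^esub> bi_prod_upto G U m <#>\<^bsub>G\<^esub> U (Suc m)"

definition bi_prod :: "('a, 'b) monoid_scheme \<Rightarrow> (nat \<Rightarrow> 'a set) \<Rightarrow> 'a set" where
  "bi_prod G U = (\<Union>m. bi_prod_upto G U m)"

text \<open>
  \<open>topology_generated_by\<close> takes a subbase. For a tower with neighborhood bases \<open>\<B> n\<close> at the neutral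
  element as in \<open>open_symmetric_base\<close>, the family below is already a base.
\<close>

definition bi_topology :: "('a, 'b) monoid_scheme \<Rightarrow> (nat \<Rightarrow> 'a set set) \<Rightarrow> 'a topology" where
  "bi_topology G \<B> = topology_generated_by
     {x <#\<^bsub>G\<^esub> bi_prod G U #>\<^bsub>G\<^esub> y | x y U. x \<in> carrier G \<and> y \<in> carrier G \<and> (\<forall>n. U n \<in> \<B> n)}"

lemma strongest_group_topology_unique:
  assumes "strongest_group_topology G T \<tau>" "strongest_group_topology G T \<sigma>"
  shows "\<tau> = \<sigma>"
proof -
  have "openin \<tau> U \<longleftrightarrow> openin \<sigma> U" for U
    using assms unfolding strongest_group_topology_def by metis
  then show ?thesis by (simp add: topology_eq)
qed

lemma strongest_group_topology_exists:
  fixes G (structure)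
  assumes tower: "group_tower G H T"
  shows "\<exists>\<tau>. strongest_group_topology G T \<tau>"
proof -
  interpret group G using tower unfolding group_tower_def by blast
  define A where "A = {\<sigma>. topological_group G \<sigma> \<and> (\<forall>n. continuous_map (T n) \<sigma> (\<lambda>x. x))}"
  define \<tau> where "\<tau> = topology_generated_by (\<Union>\<sigma>\<in>A. {U. openin \<sigma> U})"
  have tT: "topspace (T n) = H n" for n
  proof -
    have "topological_group (G\<lparr>carrier := H n\<rparr>) (T n)"
      using tower unfolding group_tower_def by blast
    then show ?thesis by (simp add: topological_group_def)
  qed
  have HG: "H n \<subseteq> carrier G" for n
    using tower unfolding group_tower_def by blast
  have tA: "topspace \<sigma> = carrier G" if "\<sigma> \<in> A" for \<sigma>
    using that by (simp add: A_def topological_group_def)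
  let ?I = "topology_generated_by {carrier G}"
  have toI: "continuous_map X ?I f" if "f ` topspace X \<subseteq> carrier G" for X :: "'c topology" and f
  proof -
    have "f -` carrier G \<inter> topspace X = topspace X" using that by auto
    then show ?thesis using that by (auto simp: continuous_on_generated_topo_iff)
  qed
  have "?I \<in> A"
    unfolding A_def topological_group_def mem_Collect_eq
    using tT HG by (intro conjI allI toI is_group) auto
  note I = this
  have tau: "topspace \<tau> = carrier G"
  proof -
    have "(\<Union>\<sigma>\<in>A. \<Union>{U. openin \<sigma> U}) = (\<Union>\<sigma>\<in>A. topspace \<sigma>)"
      by (simp add: topspace_def)
    also have "\<dots> = carrier G" using I tA by auto
    finally show ?thesis unfolding \<tau>_def topology_generated_by_topspace by blast
  qed
  have finer: "openin \<tau> U" if "\<sigma> \<in> A" "openin \<sigma> U" for \<sigma> U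
    using that unfolding \<tau>_def by (auto intro!: topology_generated_by_Basis)
  have idc: "continuous_map \<tau> \<sigma> (\<lambda>x. x)" if "\<sigma> \<in> A" for \<sigma>
    unfolding continuous_map_alt
  proof (intro conjI allI impI)
    fix U assume U: "openin \<sigma> U"
    then have "U \<subseteq> topspace \<tau>" using openin_subset tA[OF that] tau by metis
    then have "(\<lambda>x. x) -` U \<inter> topspace \<tau> = U" by auto
    then show "openin \<tau> ((\<lambda>x. x) -` U \<inter> topspace \<tau>)" using finer[OF that U] by simp
  next
    show "(\<lambda>x. x) \<in> topspace \<tau> \<rightarrow> topspace \<sigma>" using tA[OF that] tau by simp
  qed
  have into: "continuous_map X \<tau> f"
    if "\<And>\<sigma>. \<sigma> \<in> A \<Longrightarrow> continuous_map X \<sigma> f" for X :: "'c topology" and f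
    unfolding \<tau>_def
  proof (rule continuous_on_generated_topo)
    fix U assume "U \<in> (\<Union>\<sigma>\<in>A. {U. openin \<sigma> U})"
    then obtain \<sigma> where "\<sigma> \<in> A" "openin \<sigma> U" by auto
    then show "openin X (f -` U \<inter> topspace X)"
      using that[of \<sigma>] by (auto simp: continuous_map_alt)
  next
    have "f ` topspace X \<subseteq> carrier G"
      using that[OF \<open>?I \<in> A\<close>] by (auto simp: continuous_map_def)
    then show "f ` topspace X \<subseteq> \<Union> (\<Union>\<sigma>\<in>A. {U. openin \<sigma> U})"
      using tau unfolding \<tau>_def by simp
  qed
  have "continuous_map (prod_topology \<tau> \<tau>) \<tau> (\<lambda>(x, y). x \<otimes> y)"
  proof (rule into)
    fix \<sigma> assume s: "\<sigma> \<in> A"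
    have 1: "continuous_map (prod_topology \<tau> \<tau>) (prod_topology \<sigma> \<sigma>) (\<lambda>(x, y). (x, y))"
      using continuous_map_prod_top[of \<tau> \<tau> \<sigma> \<sigma> "\<lambda>x. x" "\<lambda>x. x"] idc[OF s] by simp
    have 2: "continuous_map (prod_topology \<sigma> \<sigma>) \<sigma> (\<lambda>(x, y). x \<otimes> y)"
      using s by (simp add: A_def topological_group_def)
    from continuous_map_compose[OF 1 2]
    show "continuous_map (prod_topology \<tau> \<tau>) \<sigma> (\<lambda>(x, y). x \<otimes> y)"
      by (simp add: o_def case_prod_unfold)
  qed
  moreover have "continuous_map \<tau> \<tau> (\<lambda>x. inv x)"
  proof (rule into)
    fix \<sigma> assume s: "\<sigma> \<in> A"
    then have "continuous_map \<sigma> \<sigma> (\<lambda>x. inv x)"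
      by (simp add: A_def topological_group_def)
    from continuous_map_compose[OF idc[OF s] this]
    show "continuous_map \<tau> \<sigma> (\<lambda>x. inv x)" by (simp add: o_def)
  qed
  moreover have "continuous_map (T n) \<tau> (\<lambda>x. x)" for n
    by (rule into) (simp add: A_def)
  ultimately have "strongest_group_topology G T \<tau>"
    using tau finer by (auto simp: strongest_group_topology_def topological_group_def A_def is_group)
  then show ?thesis ..
qed

lemma strongest_group_topology_g_lim:
  assumes "group_tower G H T"
  shows "strongest_group_topology G T (g_lim_topology G T)"
  unfolding g_lim_topology_def
  using strongest_group_topology_exists[OF assms] strongest_group_topology_unique
  by (metis theI)

end

theory Submission
  imports Defs
begin

text \<open>
  Every set open in the direct limit contains \<open>x \<cdot> bi_prod U\<close> around each of its points \<open>x\<close>, for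
  suitable \<open>U\<close>; bi-balancedness is needed only for the converse, namely that the bilateral products
  form a neighborhood base of a group topology. The only axiom that is not a matter of choosing the
  \<open>n\<close>-th factor small in the \<open>n\<close>-th group is \<open>bi_prod W \<cdot> bi_prod W \<subseteq> bi_prod U\<close>.
  There the central part \<open>W (m-1) \<cdot> W m \<cdot> W m \<cdot> W (m-1)\<close> of the product of two partial products is
  written as \<open>r \<cdot> v \<cdot> r'\<close> with \<open>v\<close> small in the \<open>(m-1)\<close>-st group and with \<open>r, r'\<close> all of whose
  conjugates by the \<open>(m-2)\<close>-nd group are small. Hence \<open>r\<close> and \<open>r'\<close> can be moved outwards past the
  inner factors, where they are absorbed into \<open>U m\<close>, and one descends to \<open>v\<close> and \<open>m - 1\<close>.
\<close>

section \<open>Group topologies from neighborhood bases\<close>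

lemma (in group) mult_inv_cancel_left:
  assumes "x \<in> carrier G" "y \<in> carrier G"
  shows "inv x \<otimes> (x \<otimes> y) = y" and "x \<otimes> (inv x \<otimes> y) = y"
  using assms by (simp_all add: m_assoc[symmetric])

text \<open>One preimage statement serves left translation (\<open>b = \<one>\<close>), conjugation
  (\<open>b = inv a\<close>) and translation by independent \<open>a\<close> and
  \<open>b\<close>.\<close>

lemma topological_group_two_sided_translate:
  fixes K (structure)
  assumes tg: "topological_group K T" and W: "openin T W" and a: "a \<in> carrier K" and b: "b \<in> carrier K"
  shows "openin T {z \<in> carrier K. a \<otimes> z \<otimes> b \<in> W}"
proof -
  have top: "topspace T = carrier K"
    and mult: "continuous_map (prod_topology T T) T (\<lambda>(x, y). x \<otimes> y)"
    using tg by (auto simp: topological_group_def)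
  have "continuous_map T (prod_topology T T) (\<lambda>z. (a, z))"
    using a top by (simp add: continuous_map_pairedI)
  from continuous_map_compose[OF this mult]
  have "continuous_map T T (\<lambda>z. a \<otimes> z)" by (simp add: o_def)
  then have "continuous_map T (prod_topology T T) (\<lambda>z. (a \<otimes> z, b))"
    using b top by (simp add: continuous_map_pairedI)
  from continuous_map_compose[OF this mult]
  have "continuous_map T T (\<lambda>z. a \<otimes> z \<otimes> b)" by (simp add: o_def)
  from openin_continuous_map_preimage[OF this W] show ?thesis by (simp add: top)
qed

lemma topological_group_square_subset:
  fixes K (structure)
  assumes tg: "topological_group K T" and W: "openin T W" "\<one> \<in> W"
  obtains V where "openin T V" "\<one> \<in> V" "\<And>x y. x \<in> V \<Longrightarrow> y \<in> V \<Longrightarrow> x \<otimes> y \<in> W"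
proof -
  interpret group K using tg by (simp add: topological_group_def)
  have top: "topspace T = carrier K"
    and mult: "continuous_map (prod_topology T T) T (\<lambda>(x, y). x \<otimes> y)"
    using tg by (auto simp: topological_group_def)
  have "openin (prod_topology T T) {p \<in> topspace (prod_topology T T). (\<lambda>(x, y). x \<otimes> y) p \<in> W}"
    by (rule openin_continuous_map_preimage[OF mult W(1)])
  moreover have "(\<one>, \<one>) \<in> {p \<in> topspace (prod_topology T T). (\<lambda>(x, y). x \<otimes> y) p \<in> W}"
    using W(2) by (simp add: top)
  ultimately obtain A B where AB: "openin T A" "openin T B" "\<one> \<in> A" "\<one> \<in> B"
    "A \<times> B \<subseteq> {p \<in> topspace (prod_topology T T). (\<lambda>(x, y). x \<otimes> y) p \<in> W}"
    unfolding openin_prod_topology_alt by meson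
  show ?thesis
  proof (rule that)
    show "openin T (A \<inter> B)" "\<one> \<in> A \<inter> B" using AB by auto
    show "x \<otimes> y \<in> W" if "x \<in> A \<inter> B" "y \<in> A \<inter> B" for x y
      using AB(5) that by auto
  qed
qed

text \<open>Only left cosets enter. \<open>topology\<close> yields the intended object only for a
  predicate satisfying \<open>istopology\<close>; this is checked inside the locale, where
  directedness handles intersections.\<close>

definition nbhd_base_topology :: "('a, 'b) monoid_scheme \<Rightarrow> 'a set set \<Rightarrow> 'a topology" where
  "nbhd_base_topology G \<N> =
     topology (\<lambda>W. W \<subseteq> carrier G \<and> (\<forall>x\<in>W. \<exists>N\<in>\<N>. x <#\<^bsub>G\<^esub> N \<subseteq> W))"

text \<open>The classical axioms on a system of neighborhoods of \<open>\<one>\<close> that defines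
  a group topology, with no separation axiom. \<open>base_open\<close> makes the members open rather
  than mere neighborhoods.\<close>

locale group_nbhd_base = group G for G (structure) +
  fixes \<N> :: "'a set set"
  assumes nonempty: "\<N> \<noteq> {}"
    and subset_carrier: "N \<in> \<N> \<Longrightarrow> N \<subseteq> carrier G"
    and one_mem: "N \<in> \<N> \<Longrightarrow> \<one> \<in> N"
    and directed: "N \<in> \<N> \<Longrightarrow> N' \<in> \<N> \<Longrightarrow> \<exists>M\<in>\<N>. M \<subseteq> N \<inter> N'"
    and square: "N \<in> \<N> \<Longrightarrow> \<exists>M\<in>\<N>. \<forall>x\<in>M. \<forall>y\<in>M. x \<otimes> y \<in> N"
    and inverse: "N \<in> \<N> \<Longrightarrow> \<exists>M\<in>\<N>. \<forall>x\<in>M. inv x \<in> N"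
    and conjugate: "N \<in> \<N> \<Longrightarrow> g \<in> carrier G \<Longrightarrow> \<exists>M\<in>\<N>. \<forall>x\<in>M. g \<otimes> x \<otimes> inv g \<in> N"
    and base_open: "N \<in> \<N> \<Longrightarrow> g \<in> N \<Longrightarrow> \<exists>M\<in>\<N>. \<forall>x\<in>M. g \<otimes> x \<in> N"
begin

lemma openin_nbhd_base_topology:
  "openin (nbhd_base_topology G \<N>) W \<longleftrightarrow> W \<subseteq> carrier G \<and> (\<forall>x\<in>W. \<exists>N\<in>\<N>. x <# N \<subseteq> W)"
proof -
  have "istopology (\<lambda>W. W \<subseteq> carrier G \<and> (\<forall>x\<in>W. \<exists>N\<in>\<N>. x <# N \<subseteq> W))"
    unfolding istopology_def
  proof (intro conjI allI impI ballI)
    fix S S' x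
    assume S: "S \<subseteq> carrier G \<and> (\<forall>x\<in>S. \<exists>N\<in>\<N>. x <# N \<subseteq> S)"
      and S': "S' \<subseteq> carrier G \<and> (\<forall>x\<in>S'. \<exists>N\<in>\<N>. x <# N \<subseteq> S')"
    then show "S \<inter> S' \<subseteq> carrier G" by auto
    assume "x \<in> S \<inter> S'"
    with S S' obtain N N' where N: "N \<in> \<N>" "N' \<in> \<N>" "x <# N \<subseteq> S" "x <# N' \<subseteq> S'"
      by blast
    then obtain M where M: "M \<in> \<N>" "M \<subseteq> N \<inter> N'" using directed by blast
    then have "x <# M \<subseteq> S \<inter> S'" using N(3,4) unfolding l_coset_def by blast
    with M(1) show "\<exists>N\<in>\<N>. x <# N \<subseteq> S \<inter> S'" by blast
  next
    fix \<K> :: "'a set set" and x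
    assume K: "\<forall>K\<in>\<K>. K \<subseteq> carrier G \<and> (\<forall>x\<in>K. \<exists>N\<in>\<N>. x <# N \<subseteq> K)"
    then show "\<Union>\<K> \<subseteq> carrier G" by auto
    assume "x \<in> \<Union>\<K>"
    with K show "\<exists>N\<in>\<N>. x <# N \<subseteq> \<Union>\<K>" by (meson Sup_upper UnionE subset_trans)
  qed
  then show ?thesis unfolding nbhd_base_topology_def by simp
qed

lemma topspace_nbhd_base_topology: "topspace (nbhd_base_topology G \<N>) = carrier G"
proof (rule antisym)
  show "topspace (nbhd_base_topology G \<N>) \<subseteq> carrier G"
    using openin_topspace[of "nbhd_base_topology G \<N>"] unfolding openin_nbhd_base_topology by blast
  have "openin (nbhd_base_topology G \<N>) (carrier G)"
    unfolding openin_nbhd_base_topology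
  proof (intro conjI ballI subset_refl)
    fix x assume x: "x \<in> carrier G"
    obtain N where N: "N \<in> \<N>" using nonempty by auto
    then show "\<exists>N\<in>\<N>. x <# N \<subseteq> carrier G"
      using l_coset_subset_G[OF subset_carrier x] by blast
  qed
  then show "carrier G \<subseteq> topspace (nbhd_base_topology G \<N>)" by (rule openin_subset)
qed

lemma openin_l_coset:
  assumes N: "N \<in> \<N>" and x: "x \<in> carrier G"
  shows "openin (nbhd_base_topology G \<N>) (x <# N)"
  unfolding openin_nbhd_base_topology
proof (intro conjI ballI)
  show "x <# N \<subseteq> carrier G" using l_coset_subset_G[OF subset_carrier[OF N] x] .
  fix z assume "z \<in> x <# N"
  then obtain g where g: "g \<in> N" "z = x \<otimes> g" unfolding l_coset_def by auto
  then obtain M where M: "M \<in> \<N>" "\<forall>y\<in>M. g \<otimes> y \<in> N" using base_open N by blast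
  have "z \<otimes> y \<in> x <# N" if "y \<in> M" for y
  proof -
    have "z \<otimes> y = x \<otimes> (g \<otimes> y)"
      using g M N that x subset_carrier by (metis m_assoc subsetD)
    then show ?thesis using M that unfolding l_coset_def by auto
  qed
  then show "\<exists>N'\<in>\<N>. z <# N' \<subseteq> x <# N"
    using M(1) unfolding l_coset_def by blast
qed

lemma mem_l_coset: "N \<in> \<N> \<Longrightarrow> x \<in> carrier G \<Longrightarrow> x \<in> x <# N"
  using one_mem unfolding l_coset_def by force

lemma topological_group_nbhd_base_topology: "topological_group G (nbhd_base_topology G \<N>)"
proof -
  let ?\<tau> = "nbhd_base_topology G \<N>"
  have "continuous_map (prod_topology ?\<tau> ?\<tau>) ?\<tau> (\<lambda>(x, y). x \<otimes> y)"
    unfolding continuous_map_def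
  proof (intro conjI allI impI)
    show "(\<lambda>(x, y). x \<otimes> y) \<in> topspace (prod_topology ?\<tau> ?\<tau>) \<rightarrow> topspace ?\<tau>"
      by (auto simp: topspace_nbhd_base_topology)
    fix W assume W: "openin ?\<tau> W"
    show "openin (prod_topology ?\<tau> ?\<tau>)
        {p \<in> topspace (prod_topology ?\<tau> ?\<tau>). (case p of (x, y) \<Rightarrow> x \<otimes> y) \<in> W}"
      unfolding openin_prod_topology_alt
    proof (intro allI impI)
      fix x y
      assume "(x, y) \<in> {p \<in> topspace (prod_topology ?\<tau> ?\<tau>). (case p of (x, y) \<Rightarrow> x \<otimes> y) \<in> W}"
      then have xy: "x \<in> carrier G" "y \<in> carrier G" "x \<otimes> y \<in> W"
        by (auto simp: topspace_nbhd_base_topology)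
      then obtain N where N: "N \<in> \<N>" "(x \<otimes> y) <# N \<subseteq> W"
        using W unfolding openin_nbhd_base_topology by blast
      \<comment> \<open>Moving \<open>u\<close> to the right across \<open>y\<close> conjugates it
        by \<open>inv y\<close>: \<open>L\<close> controls this conjugation, \<open>M\<close> the
        remaining product of two small elements.\<close>
      obtain M where M: "M \<in> \<N>" "\<forall>u\<in>M. \<forall>v\<in>M. u \<otimes> v \<in> N" using square[OF N(1)] by blast
      obtain L where L: "L \<in> \<N>" "\<forall>u\<in>L. inv y \<otimes> u \<otimes> inv (inv y) \<in> M"
        using conjugate[OF M(1), of "inv y"] xy by blast
      have "p \<otimes> q \<in> W" if pq: "p \<in> x <# L" "q \<in> y <# M" for p q
      proof -
        obtain u v where uv: "u \<in> L" "v \<in> M" "p = x \<otimes> u" "q = y \<otimes> v"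
          using pq unfolding l_coset_def by auto
        have c: "u \<in> carrier G" "v \<in> carrier G" using uv subset_carrier M L by blast+
        have "p \<otimes> q = (x \<otimes> y) \<otimes> ((inv y \<otimes> u \<otimes> inv (inv y)) \<otimes> v)"
          using c xy uv by (simp add: m_assoc mult_inv_cancel_left)
        moreover have "(inv y \<otimes> u \<otimes> inv (inv y)) \<otimes> v \<in> N" using L M uv by blast
        ultimately show ?thesis using N(2) unfolding l_coset_def by blast
      qed
      moreover have "x <# L \<subseteq> carrier G" "y <# M \<subseteq> carrier G"
        using l_coset_subset_G subset_carrier L M xy by blast+
      ultimately show "\<exists>A B. openin ?\<tau> A \<and> openin ?\<tau> B \<and> x \<in> A \<and> y \<in> B \<and>
          A \<times> B \<subseteq> {p \<in> topspace (prod_topology ?\<tau> ?\<tau>). (case p of (x, y) \<Rightarrow> x \<otimes> y) \<in> W}"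
        using openin_l_coset mem_l_coset L(1) M(1) xy
        by (intro exI[of _ "x <# L"] exI[of _ "y <# M"])
          (auto simp: topspace_nbhd_base_topology)
    qed
  qed
  moreover have "continuous_map ?\<tau> ?\<tau> (\<lambda>x. inv x)"
    unfolding continuous_map_def
  proof (intro conjI allI impI)
    show "(\<lambda>x. inv x) \<in> topspace ?\<tau> \<rightarrow> topspace ?\<tau>"
      by (auto simp: topspace_nbhd_base_topology)
    fix W assume W: "openin ?\<tau> W"
    show "openin ?\<tau> {x \<in> topspace ?\<tau>. inv x \<in> W}"
      unfolding openin_nbhd_base_topology topspace_nbhd_base_topology
    proof (intro conjI ballI)
      fix x assume "x \<in> {x \<in> carrier G. inv x \<in> W}"
      then have x: "x \<in> carrier G" "inv x \<in> W" by auto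
      then obtain N where N: "N \<in> \<N>" "inv x <# N \<subseteq> W"
        using W unfolding openin_nbhd_base_topology by blast
      \<comment> \<open>\<open>inv (x \<otimes> u)\<close> is \<open>inv x\<close> times the
        conjugate of \<open>inv u\<close> by \<open>x\<close>; \<open>M\<close> serves the
        conjugation and \<open>L\<close> the inversion into \<open>M\<close>.\<close>
      obtain M where M: "M \<in> \<N>" "\<forall>u\<in>M. x \<otimes> u \<otimes> inv x \<in> N" using conjugate[OF N(1) x(1)] by blast
      obtain L where L: "L \<in> \<N>" "\<forall>u\<in>L. inv u \<in> M" using inverse[OF M(1)] by blast
      have "x \<otimes> u \<in> {x \<in> carrier G. inv x \<in> W}" if u: "u \<in> L" for u
      proof -
        have c: "u \<in> carrier G" using u subset_carrier L by blast
        have "inv (x \<otimes> u) = inv x \<otimes> (x \<otimes> inv u \<otimes> inv x)"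
          using c x by (simp add: inv_mult_group m_assoc[symmetric])
        then show ?thesis using c x N(2) M(2) L(2) u unfolding l_coset_def by auto
      qed
      then show "\<exists>N\<in>\<N>. x <# N \<subseteq> {x \<in> carrier G. inv x \<in> W}"
        using L(1) unfolding l_coset_def by (intro bexI[of _ L]) auto
    qed auto
  qed
  ultimately show ?thesis
    using topspace_nbhd_base_topology is_group by (simp add: topological_group_def)
qed

end

section \<open>Bilateral products in towers\<close>

locale based_group_tower =
  fixes G (structure) and H :: "nat \<Rightarrow> 'a set" and T :: "nat \<Rightarrow> 'a topology"
    and \<B> :: "nat \<Rightarrow> 'a set set"
  assumes tower: "group_tower G H T"
    and base: "open_symmetric_base (G\<lparr>carrier := H n\<rparr>) (T n) (\<B> n)"
begin

section \<open>The groups of the tower and small neighborhoods in them\<close>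

sublocale group G using tower by (simp add: group_tower_def)

lemma subgroup_H: "subgroup (H n) G"
  and topological_group_H: "topological_group (G\<lparr>carrier := H n\<rparr>) (T n)"
  and carrier_eq: "carrier G = (\<Union>n. H n)"
  and H_Suc: "H n \<subseteq> H (Suc n)"
  and T_subtopology: "T n = subtopology (T (Suc n)) (H n)"
  using tower unfolding group_tower_def by blast+

lemma topspace_T: "topspace (T n) = H n"
  using topological_group_H[of n] by (simp add: topological_group_def)

lemma H_mono: "n \<le> m \<Longrightarrow> H n \<subseteq> H m"
  by (rule lift_Suc_mono_le[of H, OF H_Suc])

lemma H_carrier: "x \<in> H n \<Longrightarrow> x \<in> carrier G"
  using carrier_eq by auto

lemma H_mult: "x \<in> H n \<Longrightarrow> y \<in> H n \<Longrightarrow> x \<otimes> y \<in> H n"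
  by (rule subgroup.m_closed[OF subgroup_H])

lemma H_inv: "x \<in> H n \<Longrightarrow> inv x \<in> H n"
  by (rule subgroup.m_inv_closed[OF subgroup_H])

lemma H_one: "\<one> \<in> H n"
  by (rule subgroup.one_closed[OF subgroup_H])

lemma base_subset: "openin (T n) W \<Longrightarrow> \<one> \<in> W \<Longrightarrow> \<exists>U\<in>\<B> n. U \<subseteq> W"
  using base[of n] openin_subset[of "T n" W] interior_of_openin[of "T n" W]
  unfolding open_symmetric_base_def is_neighborhood_def by simp

lemma base_nonempty: "\<exists>U. U \<in> \<B> n"
  using base_subset[OF openin_topspace, of n] H_one[of n] by (auto simp: topspace_T)

lemma base_openin: "U \<in> \<B> n \<Longrightarrow> openin (T n) U"
  and base_one: "U \<in> \<B> n \<Longrightarrow> \<one> \<in> U"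
  using base[of n] unfolding open_symmetric_base_def by auto

lemma base_H: "U \<in> \<B> n \<Longrightarrow> x \<in> U \<Longrightarrow> x \<in> H n"
  using base_openin openin_subset topspace_T by blast

lemma base_inv: assumes "U \<in> \<B> n" "x \<in> U" shows "inv x \<in> U"
proof -
  have "set_inv\<^bsub>G\<lparr>carrier := H n\<rparr>\<^esub> U = U"
    using base[of n] assms(1) unfolding open_symmetric_base_def by blast
  then have "inv\<^bsub>G\<lparr>carrier := H n\<rparr>\<^esub> x \<in> U"
    using assms(2) unfolding SET_INV_def by blast
  then show ?thesis using m_inv_consistent[OF subgroup_H base_H[OF assms]] by simp
qed

lemma openin_T_translate:
  "openin (T n) W \<Longrightarrow> a \<in> H n \<Longrightarrow> b \<in> H n \<Longrightarrow> openin (T n) {z \<in> H n. a \<otimes> z \<otimes> b \<in> W}"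
  using topological_group_two_sided_translate[OF topological_group_H, of n W a b] by simp

lemma openin_T_lower: "openin (T (Suc n)) W \<Longrightarrow> openin (T n) (W \<inter> H n)"
  unfolding T_subtopology[of n] by (rule openin_subtopology_Int)

lemma base_square:
  assumes "openin (T n) W" "\<one> \<in> W"
  shows "\<exists>V\<in>\<B> n. \<forall>x\<in>V. \<forall>y\<in>V. x \<otimes> y \<in> W"
proof -
  obtain O' where O: "openin (T n) O'" "\<one> \<in> O'" "\<And>x y. x \<in> O' \<Longrightarrow> y \<in> O' \<Longrightarrow> x \<otimes> y \<in> W"
    using topological_group_square_subset[OF topological_group_H[of n], of W] assms by auto
  then show ?thesis using base_subset[of n O'] by blast
qed

text \<open>Squaring twice gives products of two pairs; products of three factors are covered by
  putting \<open>\<one>\<close> into the last slot.\<close>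

lemma base_fourth_power:
  assumes "openin (T n) W" "\<one> \<in> W"
  shows "\<exists>V\<in>\<B> n. \<forall>a\<in>V. \<forall>b\<in>V. \<forall>c\<in>V. \<forall>d\<in>V. (a \<otimes> b) \<otimes> (c \<otimes> d) \<in> W"
proof -
  obtain V where "V \<in> \<B> n" "\<forall>x\<in>V. \<forall>y\<in>V. x \<otimes> y \<in> W" using base_square[OF assms] by blast
  moreover from this obtain V' where "V' \<in> \<B> n" "\<forall>x\<in>V'. \<forall>y\<in>V'. x \<otimes> y \<in> V"
    using base_square[of n V] base_openin base_one by blast
  ultimately show ?thesis by blast
qed

section \<open>Algebra of the partial bilateral products\<close>

lemma bi_prod_upto_Suc_iff:
  "x \<in> bi_prod_upto G U (Suc m) \<longleftrightarrow>
    (\<exists>a\<in>U (Suc m). \<exists>z\<in>bi_prod_upto G U m. \<exists>b\<in>U (Suc m). x = a \<otimes> z \<otimes> b)"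
  unfolding bi_prod_upto.simps set_mult_def by blast

lemma bi_prod_upto_SucI:
  "a \<in> U (Suc m) \<Longrightarrow> z \<in> bi_prod_upto G U m \<Longrightarrow> b \<in> U (Suc m) \<Longrightarrow>
    a \<otimes> z \<otimes> b \<in> bi_prod_upto G U (Suc m)"
  unfolding bi_prod_upto_Suc_iff by blast

lemma bi_prod_upto_H:
  assumes "\<And>n. U n \<in> \<B> n" and "x \<in> bi_prod_upto G U m"
  shows "x \<in> H m"
  using assms(2)
proof (induction m arbitrary: x)
  case 0
  then show ?case using base_H[OF assms(1)] H_mult by (auto simp: set_mult_def)
next
  case (Suc m)
  then obtain a z b where "a \<in> U (Suc m)" "z \<in> bi_prod_upto G U m" "b \<in> U (Suc m)"
    "x = a \<otimes> z \<otimes> b" unfolding bi_prod_upto_Suc_iff by blast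
  then have "a \<in> H (Suc m)" "z \<in> H (Suc m)" "b \<in> H (Suc m)"
    using base_H[OF assms(1)] Suc.IH H_mono[of m "Suc m"] by auto
  then show ?case using H_mult \<open>x = a \<otimes> z \<otimes> b\<close> by blast
qed

lemma
  assumes "\<And>n. U n \<in> \<B> n"
  shows bi_prod_upto_one: "\<one> \<in> bi_prod_upto G U m"
    and bi_prod_upto_factor: "U m \<subseteq> bi_prod_upto G U m"
proof -
  have one: "\<one> \<in> bi_prod_upto G U m" for m
  proof (induction m)
    case 0
    have "\<one> \<otimes> \<one> \<in> U 0 <#> U 0" using base_one[OF assms] unfolding set_mult_def by blast
    then show ?case by simp
  next
    case (Suc m)
    then show ?case
      using bi_prod_upto_SucI[of \<one> U m \<one> \<one>] base_one[OF assms] by simp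
  qed
  then show "\<one> \<in> bi_prod_upto G U m" .
  have H: "x \<in> carrier G" if "x \<in> U n" for x n using base_H[OF assms that] H_carrier by blast
  show "U m \<subseteq> bi_prod_upto G U m"
  proof (cases m)
    case 0
    have "x \<otimes> \<one> \<in> U 0 <#> U 0" if "x \<in> U 0" for x
      using that base_one[OF assms] unfolding set_mult_def by blast
    then show ?thesis using 0 H by auto
  next
    case (Suc k)
    have "x \<otimes> \<one> \<otimes> \<one> \<in> bi_prod_upto G U (Suc k)" if "x \<in> U (Suc k)" for x
      using bi_prod_upto_SucI[of x U k, OF that one base_one[OF assms]] .
    then show ?thesis using Suc H by auto
  qed
qed

text \<open>Padding with \<open>\<one>\<close> on both sides raises the level by one.\<close>

lemma bi_prod_upto_mono:
  assumes "\<And>n. U n \<in> \<B> n" and "m \<le> k"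
  shows "bi_prod_upto G U m \<subseteq> bi_prod_upto G U k"
  using assms(2)
proof (rule lift_Suc_mono_le[of "bi_prod_upto G U", rotated])
  fix n
  show "bi_prod_upto G U n \<subseteq> bi_prod_upto G U (Suc n)"
  proof
    fix x assume x: "x \<in> bi_prod_upto G U n"
    have "\<one> \<otimes> x \<otimes> \<one> \<in> bi_prod_upto G U (Suc n)"
      using bi_prod_upto_SucI[OF base_one[OF assms(1)] x base_one[OF assms(1)]] .
    then show "x \<in> bi_prod_upto G U (Suc n)"
      using H_carrier[OF bi_prod_upto_H[OF assms(1) x]] by simp
  qed
qed

lemma bi_prod_iff: "x \<in> bi_prod G U \<longleftrightarrow> (\<exists>m. x \<in> bi_prod_upto G U m)"
  by (simp add: bi_prod_def)

lemma bi_prod_upto_subset: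
  assumes "\<And>n. n \<le> m \<Longrightarrow> V n \<subseteq> U n"
  shows "bi_prod_upto G V m \<subseteq> bi_prod_upto G U m"
  using assms
proof (induction m)
  case 0
  then show ?case unfolding bi_prod_upto.simps by (intro mono_set_mult) blast+
next
  case (Suc m)
  have "bi_prod_upto G V m \<subseteq> bi_prod_upto G U m" by (rule Suc.IH) (rule Suc.prems, simp)
  then show ?case unfolding bi_prod_upto.simps by (intro mono_set_mult Suc.prems) auto
qed

lemma bi_prod_upto_cong:
  assumes "\<And>n. n \<le> m \<Longrightarrow> V n = U n"
  shows "bi_prod_upto G V m = bi_prod_upto G U m"
proof (rule antisym)
  show "bi_prod_upto G V m \<subseteq> bi_prod_upto G U m"
    by (rule bi_prod_upto_subset) (simp add: assms)
  show "bi_prod_upto G U m \<subseteq> bi_prod_upto G V m"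
    by (rule bi_prod_upto_subset) (simp add: assms)
qed

text \<open>The factors form a palindrome of symmetric sets, so inverting a product, which reverses
  its order, gives a product of the same form.\<close>

lemma bi_prod_upto_inv:
  assumes "\<And>n. U n \<in> \<B> n" and "x \<in> bi_prod_upto G U m"
  shows "inv x \<in> bi_prod_upto G U m"
  using assms(2)
proof (induction m arbitrary: x)
  case 0
  then obtain a b where *: "a \<in> U 0" "b \<in> U 0" "x = a \<otimes> b" by (auto simp: set_mult_def)
  have "a \<in> carrier G" "b \<in> carrier G" using * base_H[OF assms(1)] H_carrier by blast+
  then have "inv x = inv b \<otimes> inv a" using * by (simp add: inv_mult_group)
  then show ?case using * base_inv[OF assms(1)] by (auto simp: set_mult_def)
next
  case (Suc m)
  then obtain a z b where *: "a \<in> U (Suc m)" "z \<in> bi_prod_upto G U m" "b \<in> U (Suc m)"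
    "x = a \<otimes> z \<otimes> b" unfolding bi_prod_upto_Suc_iff by blast
  have c: "a \<in> carrier G" "z \<in> carrier G" "b \<in> carrier G"
    using * base_H[OF assms(1)] bi_prod_upto_H[OF assms(1)] H_carrier by blast+
  have "inv x = inv b \<otimes> inv z \<otimes> inv a" using * c by (simp add: inv_mult_group m_assoc)
  then show ?case
    using bi_prod_upto_SucI[OF base_inv[OF assms(1) *(3)] Suc.IH[OF *(2)] base_inv[OF assms(1) *(1)]]
    by simp
qed

section \<open>Open partial products, small partial products and their translates\<close>

lemma openin_set_mult:
  assumes "S \<subseteq> H n" "openin (T n) W"
  shows "openin (T n) (S <#> W)"
proof -
  have W: "w \<in> H n" if "w \<in> W" for w using openin_subset[OF assms(2)] topspace_T that by blast
  have "S <#> W = (\<Union>s\<in>S. {z \<in> H n. inv s \<otimes> z \<otimes> \<one> \<in> W})"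
  proof (rule Set.set_eqI, rule iffI)
    fix x assume "x \<in> S <#> W"
    then obtain s w where *: "s \<in> S" "w \<in> W" "x = s \<otimes> w" by (auto simp: set_mult_def)
    have c: "s \<in> carrier G" "w \<in> carrier G" using * W assms(1) H_carrier by blast+
    have "x \<in> H n" using * W assms(1) H_mult by blast
    moreover have "inv s \<otimes> x \<otimes> \<one> = w" using * c by (simp add: mult_inv_cancel_left)
    ultimately show "x \<in> (\<Union>s\<in>S. {z \<in> H n. inv s \<otimes> z \<otimes> \<one> \<in> W})" using * by blast
  next
    fix x assume "x \<in> (\<Union>s\<in>S. {z \<in> H n. inv s \<otimes> z \<otimes> \<one> \<in> W})"
    then obtain s where *: "s \<in> S" "x \<in> H n" "inv s \<otimes> x \<otimes> \<one> \<in> W" by auto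
    have "s \<in> carrier G" "x \<in> carrier G" using * assms(1) H_carrier by blast+
    then have "x = s \<otimes> (inv s \<otimes> x \<otimes> \<one>)" by (simp add: mult_inv_cancel_left)
    then show "x \<in> S <#> W" using * unfolding set_mult_def by blast
  qed
  moreover have "openin (T n) {z \<in> H n. inv s \<otimes> z \<otimes> \<one> \<in> W}" if "s \<in> S" for s
    using openin_T_translate[OF assms(2) H_inv H_one] assms(1) that by blast
  ultimately show ?thesis by (auto intro!: openin_Union)
qed

text \<open>The rightmost factor \<open>U m\<close> is open in \<open>T m\<close> and everything to
  its left lies in \<open>H m\<close>; the product is a union of translates of that one
  factor.\<close>

lemma openin_bi_prod_upto:
  assumes "\<And>n. U n \<in> \<B> n"
  shows "openin (T m) (bi_prod_upto G U m)"
proof (cases m)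
  case 0
  then show ?thesis
    using openin_set_mult[OF _ base_openin[OF assms]] base_H[OF assms] by auto
next
  case (Suc k)
  have "a \<otimes> z \<in> H m" if "a \<in> U m" "z \<in> bi_prod_upto G U k" for a z
    using base_H[OF assms that(1)] bi_prod_upto_H[OF assms that(2)] H_mono[of k m] H_mult Suc by auto
  then have "U m <#> bi_prod_upto G U k \<subseteq> H m" by (auto simp: set_mult_def)
  then show ?thesis using openin_set_mult[OF _ base_openin[OF assms]] Suc by auto
qed

text \<open>Factors are chosen from outside inwards: first an outermost \<open>A\<close> whose
  fourfold products stay in \<open>W\<close>, then an inner partial product inside the trace of
  \<open>A\<close> on \<open>H m\<close>. Beyond index \<open>m\<close> any members of the bases
  serve.\<close>

lemma bi_prod_upto_subset_nbhd:
  assumes "openin (T m) W" "\<one> \<in> W"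
  shows "\<exists>V. (\<forall>n. V n \<in> \<B> n) \<and> bi_prod_upto G V m \<subseteq> W"
  using assms
proof (induction m arbitrary: W)
  case 0
  obtain A where A: "A \<in> \<B> 0" "\<forall>x\<in>A. \<forall>y\<in>A. x \<otimes> y \<in> W" using base_square[OF 0] by blast
  obtain B where B: "\<And>n. B n \<in> \<B> n" using base_nonempty by metis
  show ?case
    using A B by (intro exI[of _ "B(0 := A)"]) (auto simp: set_mult_def)
next
  case (Suc m)
  obtain A where A: "A \<in> \<B> (Suc m)"
    "\<forall>a\<in>A. \<forall>b\<in>A. \<forall>c\<in>A. \<forall>d\<in>A. (a \<otimes> b) \<otimes> (c \<otimes> d) \<in> W"
    using base_fourth_power[OF Suc.prems] by blast
  obtain B where B: "\<And>n. B n \<in> \<B> n" "bi_prod_upto G B m \<subseteq> A \<inter> H m"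
    using Suc.IH[OF openin_T_lower[OF base_openin[OF A(1)]]] base_one[OF A(1)] H_one by blast
  let ?V = "B(Suc m := A)"
  have V: "\<And>n. ?V n \<in> \<B> n" using A B by simp
  have "bi_prod_upto G ?V m \<subseteq> A" using B(2) bi_prod_upto_cong[of m ?V B] by simp
  moreover have "a \<otimes> z \<otimes> b \<in> W" if "a \<in> A" "z \<in> A" "b \<in> A" for a z b
  proof -
    have "(a \<otimes> z) \<otimes> (b \<otimes> \<one>) = a \<otimes> z \<otimes> b"
      using that base_H[OF A(1), THEN H_carrier] by simp
    then show ?thesis using A(2) that base_one[OF A(1)] by metis
  qed
  ultimately have "bi_prod_upto G ?V (Suc m) \<subseteq> W"
    unfolding subset_iff bi_prod_upto_Suc_iff by auto
  then show ?case using V by blast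
qed

text \<open>Up to a level \<open>m\<close> whose group contains \<open>g\<close> and
  \<open>h\<close>, this is continuity of translations in a single topological group. Beyond it,
  \<open>g\<close> and \<open>h\<close> are moved inwards and the outer factors they cross become
  conjugates. The cases \<open>h = inv g\<close> and \<open>h = \<one>\<close> give the conjugation
  and openness axioms for the base.\<close>

lemma bi_prod_two_sided_translate:
  assumes U: "\<And>n. U n \<in> \<B> n" and g: "g \<in> carrier G" and h: "h \<in> carrier G"
    and gh: "g \<otimes> h \<in> bi_prod G U"
  shows "\<exists>V. (\<forall>n. V n \<in> \<B> n) \<and> (\<forall>x\<in>bi_prod G V. g \<otimes> x \<otimes> h \<in> bi_prod G U)"
proof -
  obtain i j k where ijk: "g \<in> H i" "h \<in> H j" "g \<otimes> h \<in> bi_prod_upto G U k"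
    using g h gh by (auto simp: carrier_eq bi_prod_iff)
  define m where "m = max i (max j k)"
  have "i \<le> m" "j \<le> m" "k \<le> m" by (auto simp: m_def)
  then have gm: "g \<in> H n" "h \<in> H n" if "m \<le> n" for n
    using ijk that H_mono[of i n] H_mono[of j n] by auto
  have ghm: "g \<otimes> h \<in> bi_prod_upto G U m" using bi_prod_upto_mono[OF U \<open>k \<le> m\<close>] ijk by auto
  have "openin (T m) {z \<in> H m. g \<otimes> z \<otimes> h \<in> bi_prod_upto G U m}"
    using openin_T_translate[OF openin_bi_prod_upto[OF U]] gm by blast
  moreover have "\<one> \<in> {z \<in> H m. g \<otimes> z \<otimes> h \<in> bi_prod_upto G U m}" using H_one ghm g by simp
  ultimately obtain A where A: "\<And>n. A n \<in> \<B> n"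
    "bi_prod_upto G A m \<subseteq> {z \<in> H m. g \<otimes> z \<otimes> h \<in> bi_prod_upto G U m}"
    using bi_prod_upto_subset_nbhd by meson
  \<comment> \<open>From level \<open>m\<close> on, conjugates of the factor by \<open>g\<close> and
    by \<open>inv h\<close> must fall into \<open>U n\<close>; for smaller \<open>n\<close> any
    member of the base will do.\<close>
  have "\<exists>B. B \<in> \<B> n \<and> (m \<le> n \<longrightarrow> (\<forall>z\<in>B. g \<otimes> z \<otimes> inv g \<in> U n \<and> inv h \<otimes> z \<otimes> h \<in> U n))" for n
  proof (cases "m \<le> n")
    case True
    let ?W = "{z \<in> H n. g \<otimes> z \<otimes> inv g \<in> U n} \<inter> {z \<in> H n. inv h \<otimes> z \<otimes> h \<in> U n}"
    have "openin (T n) ?W" using True gm H_inv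
      by (intro openin_Int openin_T_translate base_openin[OF U]) auto
    moreover have "\<one> \<in> ?W" using H_one g h base_one[OF U] by simp
    ultimately show ?thesis using base_subset[of n ?W] by blast
  qed (use A in blast)
  then obtain B where B: "\<And>n. B n \<in> \<B> n"
    "\<And>n z. m \<le> n \<Longrightarrow> z \<in> B n \<Longrightarrow> g \<otimes> z \<otimes> inv g \<in> U n \<and> inv h \<otimes> z \<otimes> h \<in> U n" by metis
  define V where "V n = (if n \<le> m then A n else B n)" for n
  have V: "\<And>n. V n \<in> \<B> n" using A B by (simp add: V_def)
  have step: "g \<otimes> x \<otimes> h \<in> bi_prod_upto G U n" if "m \<le> n" "x \<in> bi_prod_upto G V n" for x n
    using that
  proof (induction n arbitrary: x rule: dec_induct)
    case base
    have "bi_prod_upto G V m = bi_prod_upto G A m" by (rule bi_prod_upto_cong) (simp add: V_def)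
    then show ?case using base A(2) by auto
  next
    case (step n)
    then obtain a z b where *: "a \<in> V (Suc n)" "z \<in> bi_prod_upto G V n" "b \<in> V (Suc n)"
      "x = a \<otimes> z \<otimes> b" unfolding bi_prod_upto_Suc_iff by blast
    have c: "a \<in> carrier G" "z \<in> carrier G" "b \<in> carrier G"
      using * base_H[OF V] bi_prod_upto_H[OF V] H_carrier by blast+
    have "V (Suc n) = B (Suc n)" using step by (simp add: V_def)
    then have "g \<otimes> a \<otimes> inv g \<in> U (Suc n)" "inv h \<otimes> b \<otimes> h \<in> U (Suc n)"
      using * B(2)[of "Suc n"] step(1) by auto
    moreover have "g \<otimes> x \<otimes> h = (g \<otimes> a \<otimes> inv g) \<otimes> (g \<otimes> z \<otimes> h) \<otimes> (inv h \<otimes> b \<otimes> h)"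
      using * c g h by (simp add: m_assoc mult_inv_cancel_left)
    ultimately show ?case
      using bi_prod_upto_SucI[OF _ step.IH[OF *(2)]] by simp
  qed
  have "g \<otimes> x \<otimes> h \<in> bi_prod G U" if "x \<in> bi_prod G V" for x
  proof -
    obtain n where "x \<in> bi_prod_upto G V n" using \<open>x \<in> bi_prod G V\<close> by (auto simp: bi_prod_iff)
    \<comment> \<open>The inductive claim starts at level \<open>m\<close>, so the product is first
      raised to at least that level.\<close>
    then have "x \<in> bi_prod_upto G V (max m n)" using bi_prod_upto_mono[OF V, of n "max m n"] by auto
    then have "g \<otimes> x \<otimes> h \<in> bi_prod_upto G U (max m n)" by (intro step) simp
    then show ?thesis unfolding bi_prod_iff by blast
  qed
  then show ?thesis using V by blast
qed

section \<open>Bi-balancedness and the product of two bilateral products\<close>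

text \<open>With \<open>?R\<close> the conjugation root of \<open>A\<close>, the product of
  \<open>?R\<close>, \<open>V\<close> and \<open>?R\<close> is a neighborhood of
  \<open>\<one>\<close> in the largest of the three groups, so it contains threefold products from a
  small \<open>Q\<close>. The three slots are meant for a central element and its two
  neighbors.\<close>

lemma bi_balanced_factorization:
  assumes bal: "bi_balanced_tower G H T"
    and V: "V \<in> \<B> (Suc n)" and A: "A \<in> \<B> (Suc (Suc n))"
  shows "\<exists>Q\<in>\<B> (Suc (Suc n)). \<forall>a\<in>Q. \<forall>b\<in>Q. \<forall>c\<in>Q. \<exists>r v r'.
    a \<otimes> b \<otimes> c = r \<otimes> v \<otimes> r' \<and> v \<in> V \<and> r \<in> H (Suc (Suc n)) \<and> r' \<in> H (Suc (Suc n)) \<and>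
    (\<forall>h\<in>H n. h \<otimes> r \<otimes> inv h \<in> A \<and> h \<otimes> r' \<otimes> inv h \<in> A)"
proof -
  let ?k = "Suc (Suc n)"
  let ?K = "G\<lparr>carrier := H ?k\<rparr>"
  let ?R = "conj_root ?K (H n) A"
  have bal': "bi_balanced_triple ?K (T ?k) (H (Suc n)) (H n)"
    using bal unfolding bi_balanced_tower_def
    by (metis Suc_eq_plus1 add_2_eq_Suc')
  have "is_neighborhood (subtopology (T ?k) (H (Suc n))) \<one>\<^bsub>?K\<^esub> V"
    using base_openin[OF V] base_one[OF V] openin_subset[OF base_openin[OF V]]
    unfolding T_subtopology[of "Suc n", symmetric] is_neighborhood_def
    by (simp add: interior_of_openin)
  moreover have "is_neighborhood (T ?k) \<one>\<^bsub>?K\<^esub> A"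
    using base_openin[OF A] base_one[OF A] openin_subset[OF base_openin[OF A]]
    unfolding is_neighborhood_def by (simp add: interior_of_openin)
  ultimately have "is_neighborhood (T ?k) \<one>\<^bsub>?K\<^esub> (?R <#>\<^bsub>?K\<^esub> V <#>\<^bsub>?K\<^esub> ?R)"
    using bal' unfolding bi_balanced_triple_def by blast
  then have "\<one> \<in> T ?k interior_of (?R <#>\<^bsub>?K\<^esub> V <#>\<^bsub>?K\<^esub> ?R)"
    by (simp add: is_neighborhood_def)
  then obtain Q where Q: "Q \<in> \<B> ?k"
    "\<forall>a\<in>Q. \<forall>b\<in>Q. \<forall>c\<in>Q. \<forall>d\<in>Q. (a \<otimes> b) \<otimes> (c \<otimes> d) \<in> T ?k interior_of (?R <#>\<^bsub>?K\<^esub> V <#>\<^bsub>?K\<^esub> ?R)"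
    using base_fourth_power[OF openin_interior_of] by blast
  \<comment> \<open>\<open>conj_root\<close> uses the inverse of the subgroup structure, which
    agrees with that of \<open>G\<close> on \<open>H n\<close>.\<close>
  have R: "r \<in> H ?k \<and> (\<forall>h\<in>H n. h \<otimes> r \<otimes> inv h \<in> A)" if "r \<in> ?R" for r
  proof -
    have "inv\<^bsub>?K\<^esub> h = inv h" if "h \<in> H n" for h
      using m_inv_consistent[OF subgroup_H] H_mono[of n ?k] that by auto
    then show ?thesis using that by (simp add: conj_root_def)
  qed
  show ?thesis
  proof (rule bexI[OF _ Q(1)], intro ballI)
    fix a b c assume abc: "a \<in> Q" "b \<in> Q" "c \<in> Q"
    have "(a \<otimes> b) \<otimes> (c \<otimes> \<one>) \<in> ?R <#>\<^bsub>?K\<^esub> V <#>\<^bsub>?K\<^esub> ?R"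
      by (rule subsetD[OF interior_of_subset]) (use Q(2) abc base_one[OF Q(1)] in blast)
    moreover have "(a \<otimes> b) \<otimes> (c \<otimes> \<one>) = a \<otimes> b \<otimes> c"
      using abc base_H[OF Q(1), THEN H_carrier] by simp
    ultimately obtain r v r' where "r \<in> ?R" "v \<in> V" "r' \<in> ?R" "a \<otimes> b \<otimes> c = r \<otimes> v \<otimes> r'"
      by (auto simp: set_mult_def)
    then show "\<exists>r v r'. a \<otimes> b \<otimes> c = r \<otimes> v \<otimes> r' \<and> v \<in> V \<and> r \<in> H ?k \<and> r' \<in> H ?k \<and>
        (\<forall>h\<in>H n. h \<otimes> r \<otimes> inv h \<in> A \<and> h \<otimes> r' \<otimes> inv h \<in> A)"
      using R by blast
  qed
qed

lemma bi_prod_square: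
  assumes bal: "bi_balanced_tower G H T" and U: "\<And>n. U n \<in> \<B> n"
  shows "\<exists>W. (\<forall>n. W n \<in> \<B> n) \<and> (\<forall>x\<in>bi_prod G W. \<forall>y\<in>bi_prod G W. x \<otimes> y \<in> bi_prod G U)"
proof -
  \<comment> \<open>\<open>A n\<close> provides room inside \<open>U n\<close>: each outer factor
    built below collects at most four elements of it.\<close>
  have "\<forall>n. \<exists>A\<in>\<B> n. \<forall>a\<in>A. \<forall>b\<in>A. \<forall>c\<in>A. \<forall>d\<in>A. (a \<otimes> b) \<otimes> (c \<otimes> d) \<in> U n"
    using base_fourth_power base_openin[OF U] base_one[OF U] by blast
  then obtain A where A: "\<And>n. A n \<in> \<B> n"
    and A4: "\<And>n a b c d. a \<in> A n \<Longrightarrow> b \<in> A n \<Longrightarrow> c \<in> A n \<Longrightarrow> d \<in> A n \<Longrightarrow> (a \<otimes> b) \<otimes> (c \<otimes> d) \<in> U n"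
    by metis
  define factors where "factors n Q V \<longleftrightarrow> (\<forall>a\<in>Q. \<forall>b\<in>Q. \<forall>c\<in>Q. \<exists>r v r'.
    a \<otimes> b \<otimes> c = r \<otimes> v \<otimes> r' \<and> v \<in> V \<and> r \<in> H (Suc (Suc n)) \<and> r' \<in> H (Suc (Suc n)) \<and>
    (\<forall>h\<in>H n. h \<otimes> r \<otimes> inv h \<in> A (Suc (Suc n)) \<and> h \<otimes> r' \<otimes> inv h \<in> A (Suc (Suc n))))" for n Q V
  \<comment> \<open>Note the shift: \<open>Q n\<close> is a neighborhood in \<open>H (Suc n)\<close>.\<close>
  have "\<exists>Q. \<forall>n. (Q n \<in> \<B> (Suc n) \<and> (n = 0 \<longrightarrow> Q n = A 1)) \<and> factors n (Q (Suc n)) (Q n)"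
  \<comment> \<open>The sequence starts at \<open>A 1\<close>, where the descent of the centre will
    end; each next set is the one whose threefold products factor through the preceding set.\<close>
  proof (rule dependent_nat_choice)
    show "\<exists>x. x \<in> \<B> (Suc 0) \<and> (0 = (0::nat) \<longrightarrow> x = A 1)" using A[of 1] by auto
    fix V n assume "V \<in> \<B> (Suc n) \<and> (n = 0 \<longrightarrow> V = A 1)"
    then show "\<exists>y. (y \<in> \<B> (Suc (Suc n)) \<and> (Suc n = 0 \<longrightarrow> y = A 1)) \<and> factors n y V"
      using bi_balanced_factorization[OF bal _ A[of "Suc (Suc n)"], of V]
      unfolding factors_def by blast
  qed
  then obtain Q where Q: "\<And>n. Q n \<in> \<B> (Suc n)" and Q0: "Q 0 = A 1"
    and Qf: "\<And>n. factors n (Q (Suc n)) (Q n)" by metis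
  \<comment> \<open>Four roles of \<open>W n\<close>: outer factor (\<open>A n\<close>), factor
    absorbed one level up (\<open>A (Suc n)\<close>), neighbor of the centre (\<open>Q n\<close>),
    and one of the two factors meeting in the middle of \<open>x \<otimes> y\<close>, whose product
    must lie in \<open>Q k\<close> for \<open>n = Suc k\<close>.\<close>
  have "\<exists>W. W \<in> \<B> n \<and> W \<subseteq> A n \<and> W \<subseteq> A (Suc n) \<and> W \<subseteq> Q n \<and>
      (\<forall>k. n = Suc k \<longrightarrow> (\<forall>x\<in>W. \<forall>y\<in>W. x \<otimes> y \<in> Q k))" for n
  proof -
    obtain S where S: "S \<in> \<B> n" "\<forall>k. n = Suc k \<longrightarrow> (\<forall>x\<in>S. \<forall>y\<in>S. x \<otimes> y \<in> Q k)"
    proof (cases n)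
      case 0
      then show ?thesis using that[OF A] by auto
    next
      case (Suc k)
      then show ?thesis using that base_square[of n "Q k"] base_openin[OF Q] base_one[OF Q] by auto
    qed
    \<comment> \<open>\<open>A (Suc n)\<close> and \<open>Q n\<close> are open one level up, in
      \<open>T (Suc n)\<close>, hence their traces on \<open>H n\<close>.\<close>
    let ?O = "S \<inter> A n \<inter> (A (Suc n) \<inter> H n) \<inter> (Q n \<inter> H n)"
    have "openin (T n) ?O"
      by (intro openin_Int[of "T n"] openin_T_lower base_openin S A Q)
    moreover have "\<one> \<in> ?O" using base_one A Q S H_one by blast
    ultimately obtain W where "W \<in> \<B> n" "W \<subseteq> ?O" using base_subset by blast
    then show ?thesis using S(2) by blast
  qed
  then obtain W where W: "\<And>n. W n \<in> \<B> n" and WA: "\<And>n. W n \<subseteq> A n" and WA': "\<And>n. W n \<subseteq> A (Suc n)"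
    and WQ: "\<And>n. W n \<subseteq> Q n" and WW: "\<And>n x y. x \<in> W (Suc n) \<Longrightarrow> y \<in> W (Suc n) \<Longrightarrow> x \<otimes> y \<in> Q n"
    by metis
  have Ac: "x \<in> carrier G" if "x \<in> A n" for x n using base_H[OF A that] H_carrier by blast
  have A3: "a \<otimes> b \<otimes> c \<in> U n" if "a \<in> A n" "b \<in> A n" "c \<in> A n" for a b c n
    using A4[OF that base_one[OF A]] that Ac by simp
  have bH: "b \<in> H m" if "b \<in> bi_prod_upto G W m" for b m by (rule bi_prod_upto_H[OF W that])
  have sandwich: "w \<otimes> b \<otimes> v \<otimes> b' \<otimes> w' \<in> bi_prod_upto G U (Suc m)"
    if "w \<in> W (Suc m)" "b \<in> bi_prod_upto G W m" "v \<in> Q m" "b' \<in> bi_prod_upto G W m" "w' \<in> W (Suc m)"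
    for m w b v b' w'
    using that
  proof (induction m arbitrary: w b v b' w')
    case 0
    obtain c1 c2 c3 c4 where c: "c1 \<in> W 0" "c2 \<in> W 0" "c3 \<in> W 0" "c4 \<in> W 0"
      and bb': "b = c1 \<otimes> c2" "b' = c3 \<otimes> c4"
      using 0(2,4) unfolding bi_prod_upto.simps set_mult_def by blast
    have c: "c1 \<in> A 1" "c2 \<in> A 1" "c3 \<in> A 1" "c4 \<in> A 1" using c WA'[of 0] by auto
    have wv: "w \<in> A 1" "v \<in> A 1" "w' \<in> A 1" using 0 WA[of 1] Q0 by auto
    \<comment> \<open>Seven elements of \<open>A 1\<close> split into a group of four and a group of
      three, the new outer factors; \<open>\<one>\<close> fills the level-zero product between
      them.\<close>
    have "w \<otimes> b \<otimes> v \<otimes> b' \<otimes> w' = ((w \<otimes> c1) \<otimes> (c2 \<otimes> v)) \<otimes> \<one> \<otimes> (c3 \<otimes> c4 \<otimes> w')"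
      unfolding bb' using c[THEN Ac] wv[THEN Ac] by (simp add: m_assoc)
    moreover have "(w \<otimes> c1) \<otimes> (c2 \<otimes> v) \<in> U 1" "c3 \<otimes> c4 \<otimes> w' \<in> U 1"
      using c wv A4 A3 by auto
    ultimately show ?case
      using bi_prod_upto_SucI[OF _ bi_prod_upto_one[OF U, of 0]] by simp
  next
    case (Suc m)
    obtain c1 d c2 where b: "c1 \<in> W (Suc m)" "d \<in> bi_prod_upto G W m" "c2 \<in> W (Suc m)"
      "b = c1 \<otimes> d \<otimes> c2" using Suc.prems(2) unfolding bi_prod_upto_Suc_iff by blast
    obtain c3 d' c4 where b': "c3 \<in> W (Suc m)" "d' \<in> bi_prod_upto G W m" "c4 \<in> W (Suc m)"
      "b' = c3 \<otimes> d' \<otimes> c4" using Suc.prems(4) unfolding bi_prod_upto_Suc_iff by blast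
    \<comment> \<open>The centre and its two neighbors form a threefold product from
      \<open>Q (Suc m)\<close>; factoring it leaves a new centre \<open>u\<close> in
      \<open>Q m\<close>.\<close>
    have "c2 \<in> Q (Suc m)" "c3 \<in> Q (Suc m)" using b b' WQ by auto
    then obtain r u r' where r: "c2 \<otimes> v \<otimes> c3 = r \<otimes> u \<otimes> r'" "u \<in> Q m"
      "r \<in> H (Suc (Suc m))" "r' \<in> H (Suc (Suc m))"
      "\<And>h. h \<in> H m \<Longrightarrow> h \<otimes> r \<otimes> inv h \<in> A (Suc (Suc m)) \<and> h \<otimes> r' \<otimes> inv h \<in> A (Suc (Suc m))"
      using Qf[of m] Suc.prems(3) unfolding factors_def by meson
    have dH: "d \<in> H m" "d' \<in> H m" using b b' bH by auto
    have car: "c1 \<in> carrier G" "c2 \<in> carrier G" "c3 \<in> carrier G" "c4 \<in> carrier G"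
      "w \<in> carrier G" "w' \<in> carrier G" "v \<in> carrier G" "u \<in> carrier G" "r \<in> carrier G" "r' \<in> carrier G"
      "d \<in> carrier G" "d' \<in> carrier G"
      using b b' Suc.prems r dH base_H[OF W] base_H[OF Q] H_carrier by blast+
    \<comment> \<open>\<open>r\<close> is carried left across \<open>d\<close> and \<open>r'\<close>
      right across \<open>d'\<close>. As \<open>d\<close> and \<open>d'\<close> lie in
      \<open>H m\<close>, the resulting conjugates lie in \<open>A (Suc (Suc m))\<close>, and each
      outer group has three factors.\<close>
    let ?l = "w \<otimes> c1 \<otimes> (d \<otimes> r \<otimes> inv d)" and ?e = "d \<otimes> u \<otimes> d'"
      and ?r = "(inv d' \<otimes> r' \<otimes> d') \<otimes> c4 \<otimes> w'"
    have "w \<otimes> b \<otimes> v \<otimes> b' \<otimes> w' = w \<otimes> c1 \<otimes> d \<otimes> (c2 \<otimes> v \<otimes> c3) \<otimes> d' \<otimes> c4 \<otimes> w'"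
      using car b(4) b'(4) by (simp add: m_assoc)
    also have "\<dots> = ?l \<otimes> ?e \<otimes> ?r"
      unfolding r(1) using car by (simp add: m_assoc mult_inv_cancel_left)
    finally have eq: "w \<otimes> b \<otimes> v \<otimes> b' \<otimes> w' = ?l \<otimes> ?e \<otimes> ?r" .
    have "d \<otimes> r \<otimes> inv d \<in> A (Suc (Suc m))" "inv d' \<otimes> r' \<otimes> d' \<in> A (Suc (Suc m))"
      using r(5)[OF dH(1)] r(5)[OF H_inv[OF dH(2)]] car by simp_all
    moreover have "w \<in> A (Suc (Suc m))" "w' \<in> A (Suc (Suc m))" "c1 \<in> A (Suc (Suc m))"
      "c4 \<in> A (Suc (Suc m))" using Suc.prems b b' WA WA' by blast+
    ultimately have lr: "?l \<in> U (Suc (Suc m))" "?r \<in> U (Suc (Suc m))" using A3 by blast+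
    \<comment> \<open>The outer factors are already spent in \<open>?l\<close> and
      \<open>?r\<close>, so the induction hypothesis is applied with \<open>\<one>\<close> in their
      places.\<close>
    have "\<one> \<otimes> d \<otimes> u \<otimes> d' \<otimes> \<one> \<in> bi_prod_upto G U (Suc m)"
      using Suc.IH[OF base_one[OF W] b(2) r(2) b'(2) base_one[OF W]] .
    then have "?e \<in> bi_prod_upto G U (Suc m)" using car by simp
    then show ?case
      unfolding eq using lr by (intro bi_prod_upto_SucI[where U = U and m = "Suc m"])
  qed
  have "x \<otimes> y \<in> bi_prod G U" if xy: "x \<in> bi_prod G W" "y \<in> bi_prod G W" for x y
  proof -
    obtain i j where ij: "x \<in> bi_prod_upto G W i" "y \<in> bi_prod_upto G W j"
      using xy by (auto simp: bi_prod_iff)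
    define m where "m = max i j"
    \<comment> \<open>The level \<open>Suc m\<close> guarantees that both products have outermost
      factors to split off; the adjacent two merge into a centre in \<open>Q m\<close>.\<close>
    have "i \<le> Suc m" "j \<le> Suc m" by (auto simp: m_def)
    then have "x \<in> bi_prod_upto G W (Suc m)" "y \<in> bi_prod_upto G W (Suc m)"
      using ij bi_prod_upto_mono[OF W] by blast+
    then obtain a z b a' z' b' where *: "a \<in> W (Suc m)" "z \<in> bi_prod_upto G W m" "b \<in> W (Suc m)"
      "x = a \<otimes> z \<otimes> b" "a' \<in> W (Suc m)" "z' \<in> bi_prod_upto G W m" "b' \<in> W (Suc m)"
      "y = a' \<otimes> z' \<otimes> b'" unfolding bi_prod_upto_Suc_iff by blast
    have "a \<in> carrier G" "z \<in> carrier G" "b \<in> carrier G" "a' \<in> carrier G" "z' \<in> carrier G" "b' \<in> carrier G"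
      using * base_H[OF W] bH H_carrier by blast+
    then have "x \<otimes> y = a \<otimes> z \<otimes> (b \<otimes> a') \<otimes> z' \<otimes> b'" using * by (simp add: m_assoc)
    also have "\<dots> \<in> bi_prod_upto G U (Suc m)" using sandwich * WW by blast
    finally show ?thesis unfolding bi_prod_iff by blast
  qed
  then show ?thesis using W by blast
qed

section \<open>Comparison of the topologies\<close>

abbreviation "bi_prods \<equiv> {bi_prod G U | U. \<forall>n. U n \<in> \<B> n}"

lemma bi_prod_carrier:
  assumes "\<And>n. U n \<in> \<B> n" shows "bi_prod G U \<subseteq> carrier G"
  using bi_prod_upto_H[OF assms] H_carrier unfolding subset_iff bi_prod_iff by blast

lemma one_bi_prod:
  assumes "\<And>n. U n \<in> \<B> n" shows "\<one> \<in> bi_prod G U"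
  using bi_prod_upto_one[OF assms] unfolding bi_prod_iff by blast

lemma group_nbhd_base_bi_prods:
  assumes bal: "bi_balanced_tower G H T"
  shows "group_nbhd_base G bi_prods"
proof (unfold_locales, goal_cases)
  \<comment> \<open>Cases 1 to 8 are the locale axioms in their order of declaration;
    bi-balancedness enters in case 5, the square axiom.\<close>
  case 1
  obtain B where "\<And>n. B n \<in> \<B> n" using base_nonempty by metis
  then show ?case by blast
next
  case 2 then show ?case using bi_prod_carrier by blast
next
  case 3 then show ?case using one_bi_prod by blast
next
  case (4 N N')
  then obtain U U' where U: "\<And>n. U n \<in> \<B> n" "\<And>n. U' n \<in> \<B> n" "N = bi_prod G U" "N' = bi_prod G U'"
    by blast
  have "\<exists>V\<in>\<B> n. V \<subseteq> U n \<inter> U' n" for n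
    using base_subset[of n "U n \<inter> U' n"] openin_Int[OF base_openin[OF U(1)] base_openin[OF U(2)]]
      base_one[OF U(1)] base_one[OF U(2)] by simp
  then obtain V where V: "\<And>n. V n \<in> \<B> n" "\<And>n. V n \<subseteq> U n" "\<And>n. V n \<subseteq> U' n" by (metis le_inf_iff)
  have "bi_prod G V \<subseteq> N" "bi_prod G V \<subseteq> N'"
    unfolding U(3,4) bi_prod_def by (intro UN_mono subset_refl bi_prod_upto_subset V)+
  then have "bi_prod G V \<subseteq> N \<inter> N'" by blast
  then show ?case using V(1) by blast
next
  case (5 N)
  then obtain U where U: "\<And>n. U n \<in> \<B> n" "N = bi_prod G U" by blast
  obtain W where "\<forall>n. W n \<in> \<B> n" "\<forall>x\<in>bi_prod G W. \<forall>y\<in>bi_prod G W. x \<otimes> y \<in> bi_prod G U"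
    using bi_prod_square[of U, OF bal U(1)] by blast
  then show ?case unfolding U(2) by blast
next
  case (6 N)
  then obtain U where U: "\<And>n. U n \<in> \<B> n" "N = bi_prod G U" by blast
  have "inv x \<in> N" if x: "x \<in> N" for x
  proof -
    obtain m where "x \<in> bi_prod_upto G U m" using x U(2) by (auto simp: bi_prod_iff)
    then have "inv x \<in> bi_prod_upto G U m" by (rule bi_prod_upto_inv[of U, OF U(1)])
    then show ?thesis unfolding U(2) bi_prod_iff by blast
  qed
  then show ?case using 6 by blast
next
  case (7 N g)
  then obtain U where U: "\<And>n. U n \<in> \<B> n" "N = bi_prod G U" by blast
  have "g \<otimes> inv g \<in> bi_prod G U" using 7 one_bi_prod[OF U(1)] by simp
  then obtain V where "\<forall>n. V n \<in> \<B> n" "\<forall>x\<in>bi_prod G V. g \<otimes> x \<otimes> inv g \<in> bi_prod G U"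
    using bi_prod_two_sided_translate[OF U(1) 7(2) inv_closed[OF 7(2)]] by blast
  then show ?case unfolding U(2) by blast
next
  case (8 N g)
  then obtain U where U: "\<And>n. U n \<in> \<B> n" "N = bi_prod G U" by blast
  then have g: "g \<in> carrier G" using 8 bi_prod_carrier[OF U(1)] by blast
  then have "g \<otimes> \<one> \<in> bi_prod G U" using 8(2) U(2) by simp
  then obtain V where V: "\<forall>n. V n \<in> \<B> n" "\<forall>x\<in>bi_prod G V. g \<otimes> x \<otimes> \<one> \<in> bi_prod G U"
    using bi_prod_two_sided_translate[OF U(1) g one_closed] by blast
  have "g \<otimes> x \<in> N" if "x \<in> bi_prod G V" for x
  proof -
    have "x \<in> carrier G" using that bi_prod_carrier[of V] V(1) by blast
    then show ?thesis using V(2) that g U(2) by force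
  qed
  then show ?case using V(1) by blast
qed

text \<open>The whole product contains the single factor \<open>U n\<close>, whose translates by
  elements of \<open>H n\<close> are open in \<open>T n\<close>.\<close>

lemma continuous_inclusion_bi_prods:
  assumes bal: "bi_balanced_tower G H T"
  shows "continuous_map (T n) (nbhd_base_topology G bi_prods) (\<lambda>x. x)"
proof -
  interpret group_nbhd_base G bi_prods by (rule group_nbhd_base_bi_prods[OF bal])
  show ?thesis
    unfolding continuous_map_def
  proof (intro conjI allI impI)
    show "(\<lambda>x. x) \<in> topspace (T n) \<rightarrow> topspace (nbhd_base_topology G bi_prods)"
      using topspace_T topspace_nbhd_base_topology H_carrier by blast
    fix W assume W: "openin (nbhd_base_topology G bi_prods) W"
    show "openin (T n) {x \<in> topspace (T n). x \<in> W}"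
    proof (subst openin_subopen, intro ballI)
      fix x assume "x \<in> {x \<in> topspace (T n). x \<in> W}"
      then have x: "x \<in> H n" "x \<in> W" using topspace_T by auto
      then obtain U where U: "\<And>n. U n \<in> \<B> n" "x <# bi_prod G U \<subseteq> W"
        using W unfolding openin_nbhd_base_topology by blast
      have "{x} <#> U n \<subseteq> {x \<in> topspace (T n). x \<in> W}"
        using U(2) bi_prod_upto_factor[OF U(1), of n] x(1) H_mult base_H[OF U(1)]
        unfolding set_mult_def l_coset_def bi_prod_def topspace_T by blast
      moreover have "openin (T n) ({x} <#> U n)"
        using openin_set_mult[of "{x}" n "U n"] x(1) base_openin[OF U(1)] by blast
      moreover have "x \<in> {x} <#> U n"
        using base_one[OF U(1)] x(1) H_carrier[of x n] unfolding set_mult_def by force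
      ultimately show "\<exists>S. openin (T n) S \<and> x \<in> S \<and> S \<subseteq> {x \<in> topspace (T n). x \<in> W}" by blast
    qed
  qed
qed

text \<open>It suffices to treat the generating sets. At a point \<open>z\<close> of such a set,
  two-sided translation is applied with \<open>inv x \<otimes> z\<close> and \<open>inv y\<close>,
  whose product lies in \<open>bi_prod G U\<close>.\<close>

lemma openin_bi_topology_imp_nbhd_base:
  assumes bal: "bi_balanced_tower G H T" and W: "openin (bi_topology G \<B>) W"
  shows "openin (nbhd_base_topology G bi_prods) W"
proof -
  interpret group_nbhd_base G bi_prods by (rule group_nbhd_base_bi_prods[OF bal])
  have gen: "openin (nbhd_base_topology G bi_prods) (x <# bi_prod G U #> y)"
    if xy: "x \<in> carrier G" "y \<in> carrier G" and U: "\<And>n. U n \<in> \<B> n" for x y U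
    unfolding openin_nbhd_base_topology
  proof (intro conjI ballI)
    show "x <# bi_prod G U #> y \<subseteq> carrier G"
      using xy bi_prod_carrier[OF U] by (simp add: l_coset_subset_G r_coset_subset_G)
    fix z assume "z \<in> x <# bi_prod G U #> y"
    then obtain p where p: "p \<in> bi_prod G U" "z = x \<otimes> p \<otimes> y"
      unfolding l_coset_def r_coset_def by blast
    have c: "p \<in> carrier G" using p bi_prod_carrier[OF U] by blast
    have "(inv x \<otimes> z) \<otimes> inv y = p" using c xy p(2) by (simp add: m_assoc mult_inv_cancel_left)
    then obtain V where V: "\<forall>n. V n \<in> \<B> n"
      "\<forall>v\<in>bi_prod G V. (inv x \<otimes> z) \<otimes> v \<otimes> inv y \<in> bi_prod G U"
      using bi_prod_two_sided_translate[OF U, of "inv x \<otimes> z" "inv y"] c p xy by auto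
    have "z \<otimes> v \<in> x <# bi_prod G U #> y" if v: "v \<in> bi_prod G V" for v
    proof -
      have vc: "v \<in> carrier G" "z \<in> carrier G" using v bi_prod_carrier[of V] V(1) c p xy by auto
      have "z \<otimes> v = x \<otimes> ((inv x \<otimes> z) \<otimes> v \<otimes> inv y) \<otimes> y"
        using vc xy by (simp add: m_assoc mult_inv_cancel_left)
      then show ?thesis using V(2) v unfolding l_coset_def r_coset_def by blast
    qed
    then show "\<exists>N\<in>bi_prods. z <# N \<subseteq> x <# bi_prod G U #> y"
      using V(1) unfolding l_coset_def by (intro bexI[of _ "bi_prod G V"]) auto
  qed
  have "generate_topology_on {x <# bi_prod G U #> y | x y U.
      x \<in> carrier G \<and> y \<in> carrier G \<and> (\<forall>n. U n \<in> \<B> n)} W"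
    using W unfolding bi_topology_def openin_topology_generated_by_iff .
  then show ?thesis
  proof (induction rule: generate_topology_on.induct)
    case (Basis s)
    then obtain x y U where "x \<in> carrier G" "y \<in> carrier G" "\<And>n. U n \<in> \<B> n"
      "s = x <# bi_prod G U #> y" by blast
    then show ?case using gen by simp
  next
    case (UN K)
    show ?case by (rule openin_Union) (rule UN.IH)
  qed (simp_all add: openin_Int)
qed

text \<open>A sequence of \<open>\<sigma>\<close>-open sets, each squaring into the one before,
  bounds products of arbitrary length: with \<open>U n\<close> inside
  \<open>S (Suc (Suc n))\<close>, either half of a bilateral product telescopes into
  \<open>S 1\<close>.\<close>

lemma openin_group_topology_imp_bi_topology:
  assumes tg: "topological_group G \<sigma>" and cont: "\<And>n. continuous_map (T n) \<sigma> (\<lambda>x. x)"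
    and W: "openin \<sigma> W"
  shows "openin (bi_topology G \<B>) W"
proof (subst openin_subopen, intro ballI)
  have top: "topspace \<sigma> = carrier G" using tg by (simp add: topological_group_def)
  fix x assume xW: "x \<in> W"
  then have x: "x \<in> carrier G" using openin_subset[OF W] unfolding top by blast
  have "\<exists>S. \<forall>n. (openin \<sigma> (S n) \<and> \<one> \<in> S n \<and> (n = 0 \<longrightarrow> (\<forall>z\<in>S n. x \<otimes> z \<in> W))) \<and>
      (\<forall>a\<in>S (Suc n). \<forall>b\<in>S (Suc n). a \<otimes> b \<in> S n)"
  proof (rule dependent_nat_choice)
    have "openin \<sigma> {z \<in> carrier G. x \<otimes> z \<otimes> \<one> \<in> W}"
      using topological_group_two_sided_translate[OF tg W x one_closed] .
    then show "\<exists>S. openin \<sigma> S \<and> \<one> \<in> S \<and> (0 = (0::nat) \<longrightarrow> (\<forall>z\<in>S. x \<otimes> z \<in> W))"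
      using x xW by (intro exI[of _ "{z \<in> carrier G. x \<otimes> z \<otimes> \<one> \<in> W}"]) auto
  next
    fix S and n :: nat assume "openin \<sigma> S \<and> \<one> \<in> S \<and> (n = 0 \<longrightarrow> (\<forall>z\<in>S. x \<otimes> z \<in> W))"
    then obtain V where "openin \<sigma> V" "\<one> \<in> V" "\<And>a b. a \<in> V \<Longrightarrow> b \<in> V \<Longrightarrow> a \<otimes> b \<in> S"
      using topological_group_square_subset[OF tg, of S] by blast
    then show "\<exists>S'. (openin \<sigma> S' \<and> \<one> \<in> S' \<and> (Suc n = 0 \<longrightarrow> (\<forall>z\<in>S'. x \<otimes> z \<in> W))) \<and>
        (\<forall>a\<in>S'. \<forall>b\<in>S'. a \<otimes> b \<in> S)" by blast
  qed
  then obtain S where S: "\<And>n. openin \<sigma> (S n)" "\<And>n. \<one> \<in> S n" "\<And>z. z \<in> S 0 \<Longrightarrow> x \<otimes> z \<in> W"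
    "\<And>n a b. a \<in> S (Suc n) \<Longrightarrow> b \<in> S (Suc n) \<Longrightarrow> a \<otimes> b \<in> S n" by metis
  have Sc: "a \<in> carrier G" if "a \<in> S n" for a n using openin_subset[OF S(1)] top that by blast
  \<comment> \<open>The shift by two pays for two squarings: one joins the halves in
    \<open>S 0\<close>, the other accommodates a spare factor \<open>s\<close> carried along with
    each half.\<close>
  have "\<exists>U\<in>\<B> n. U \<subseteq> S (Suc (Suc n))" for n
  proof -
    have "openin (T n) {z \<in> topspace (T n). z \<in> S (Suc (Suc n))}"
      using openin_continuous_map_preimage[OF cont S(1)] .
    then show ?thesis
      using base_subset[of n "{z \<in> topspace (T n). z \<in> S (Suc (Suc n))}"] S(2) H_one topspace_T by blast
  qed
  then obtain U where U: "\<And>n. U n \<in> \<B> n" "\<And>n. U n \<subseteq> S (Suc (Suc n))" by metis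
  \<comment> \<open>The left and right halves have to be estimated separately: the whole products
    \<open>bi_prod_upto G U m\<close> increase with \<open>m\<close> and leave no room for a bound that shrinks.\<close>
  have halves: "\<exists>l\<in>carrier G. \<exists>r\<in>carrier G. z = l \<otimes> r \<and>
      (\<forall>s\<in>S (Suc (Suc m)). s \<otimes> l \<in> S 1 \<and> r \<otimes> s \<in> S 1)" if "z \<in> bi_prod_upto G U m" for z m
    using that
  proof (induction m arbitrary: z)
    case 0
    then obtain a b where "a \<in> U 0" "b \<in> U 0" "z = a \<otimes> b" by (auto simp: set_mult_def)
    moreover have "a \<in> S (Suc 1)" "b \<in> S (Suc 1)" using calculation U(2)[of 0] by auto
    ultimately show ?case using S(4)[of _ 1] Sc by (metis One_nat_def)
  next
    case (Suc m)
    then obtain a y b where z: "a \<in> U (Suc m)" "y \<in> bi_prod_upto G U m" "b \<in> U (Suc m)"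
      "z = a \<otimes> y \<otimes> b" unfolding bi_prod_upto_Suc_iff by blast
    obtain l r where lr: "l \<in> carrier G" "r \<in> carrier G" "y = l \<otimes> r"
      "\<forall>s\<in>S (Suc (Suc m)). s \<otimes> l \<in> S 1 \<and> r \<otimes> s \<in> S 1" using Suc.IH[OF z(2)] by blast
    have ab: "a \<in> S (Suc (Suc (Suc m)))" "b \<in> S (Suc (Suc (Suc m)))" using z U(2) by blast+
    have c: "a \<in> carrier G" "b \<in> carrier G" using ab Sc by blast+
    \<comment> \<open>The spare factor absorbs the new outer one: \<open>s \<otimes> a\<close> lies
      in \<open>S (Suc (Suc m))\<close> and is the spare factor for \<open>l\<close>, and likewise
      \<open>b \<otimes> s\<close> for \<open>r\<close>.\<close>
    have "s \<otimes> (a \<otimes> l) \<in> S 1 \<and> (r \<otimes> b) \<otimes> s \<in> S 1" if s: "s \<in> S (Suc (Suc (Suc m)))" for s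
    proof -
      have "(s \<otimes> a) \<otimes> l \<in> S 1" "r \<otimes> (b \<otimes> s) \<in> S 1" using lr(4) S(4) s ab by blast+
      then show ?thesis using c lr Sc[OF s] by (simp add: m_assoc)
    qed
    moreover have "z = (a \<otimes> l) \<otimes> (r \<otimes> b)" using c lr z by (simp add: m_assoc)
    ultimately show ?case using c lr by blast
  qed
  \<comment> \<open>The right translate by \<open>\<one>\<close> only brings the set into the form
    of the generators of \<open>bi_topology\<close>.\<close>
  have "x <# bi_prod G U #> \<one> \<subseteq> W"
  proof
    fix y assume "y \<in> x <# bi_prod G U #> \<one>"
    then obtain z where z: "z \<in> bi_prod G U" "y = x \<otimes> z \<otimes> \<one>"
      unfolding l_coset_def r_coset_def by blast
    then obtain m l r where lr: "l \<in> carrier G" "r \<in> carrier G" "z = l \<otimes> r"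
      "\<forall>s\<in>S (Suc (Suc m)). s \<otimes> l \<in> S 1 \<and> r \<otimes> s \<in> S 1" using halves unfolding bi_prod_iff by meson
    \<comment> \<open>The spare factor is taken to be \<open>\<one>\<close>.\<close>
    then have "l \<in> S 1" "r \<in> S 1" using S(2) by (metis l_one, metis r_one)
    then have "z \<in> S 0" using S(4)[of l 0 r] lr(3) by simp
    then show "y \<in> W" using S(3) z(2) x Sc by simp
  qed
  moreover have "openin (bi_topology G \<B>) (x <# bi_prod G U #> \<one>)"
    unfolding bi_topology_def using x U(1) by (intro topology_generated_by_Basis) blast
  moreover have "x \<in> x <# bi_prod G U #> \<one>"
    using one_bi_prod[OF U(1)] x unfolding l_coset_def r_coset_def by force
  ultimately show "\<exists>S. openin (bi_topology G \<B>) S \<and> x \<in> S \<and> S \<subseteq> W" by blast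
qed

end

theorem theorem5p2:
  fixes G :: "('a, 'b) monoid_scheme"
    and H :: "nat \<Rightarrow> 'a set"
    and T :: "nat \<Rightarrow> 'a topology"
    and \<B> :: "nat \<Rightarrow> 'a set set"
  assumes "bi_balanced_tower G H T"
    and "\<And>n. open_symmetric_base (G\<lparr>carrier := H n\<rparr>) (T n) (\<B> n)"
  shows "homeomorphic_map (bi_topology G \<B>) (g_lim_topology G T) (\<lambda>x. x) \<and>
         g_lim_topology G T = bi_topology G \<B>"
proof -
  have tower: "group_tower G H T" using assms(1) by (simp add: bi_balanced_tower_def)
  interpret based_group_tower G H T \<B> using tower assms(2) by unfold_locales
  interpret N: group_nbhd_base G bi_prods by (rule group_nbhd_base_bi_prods[OF assms(1)])
  have lim: "strongest_group_topology G T (g_lim_topology G T)"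
    by (rule strongest_group_topology_g_lim[OF tower])
  \<comment> \<open>One direction needs only that the limit is a group topology with continuous
    inclusions. The other passes through the group topology with base \<open>bi_prods\<close>, which
    contains all sets open in \<open>bi_topology\<close> and is contained in the limit topology
    because the latter is strongest.\<close>
  have "openin (g_lim_topology G T) W \<longleftrightarrow> openin (bi_topology G \<B>) W" for W
  proof
    assume "openin (g_lim_topology G T) W"
    then show "openin (bi_topology G \<B>) W"
      using lim openin_group_topology_imp_bi_topology unfolding strongest_group_topology_def by blast
  next
    assume "openin (bi_topology G \<B>) W"
    then have "openin (nbhd_base_topology G bi_prods) W"
      by (rule openin_bi_topology_imp_nbhd_base[OF assms(1)])
    then show "openin (g_lim_topology G T) W"
      using lim N.topological_group_nbhd_base_topology continuous_inclusion_bi_prods[OF assms(1)]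
      unfolding strongest_group_topology_def by blast
  qed
  then have eq: "g_lim_topology G T = bi_topology G \<B>" by (simp add: topology_eq)
  then show ?thesis using homeomorphic_map_id[of "bi_topology G \<B>"] by (simp add: id_def)
qed

end
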